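(* Let $f:R_{1}\rightarrow R_{2}$ be a surjective ring homomorphism, $J$ an ideal of $R_{2}$, $M_{1}$ an $R_{1}$-module, $M_{2}$ an $R_{2}$-module (regarded as an $R_{1}$-module via $f$), and $\varphi:M_{1}\rightarrow M_{2}$ a surjective $R_{1}$-module homomorphism. Consider the $(R_{1}\Join^{f}J)$-module $M_{1}\Join^{\varphi}JM_{2}$. Let $S$ be a multiplicatively closed subset of $R_{2}$ and $N_{2}$ a submodule of $M_{2}$. Then: (1) $N_{2}$ is an $S$-prime submodule of $M_{2}$ if and only if $\overline{N_{2}}^{\varphi}$ is an $\overline{S}^{\varphi}$-prime submodule of $M_{1}\Join^{\varphi}JM_{2}$. (2) If $\overline{N_{2}}^{\varphi}$ is an $\overline{S}^{\varphi}$-prime submodule of $M_{1}\Join^{\varphi}JM_{2}$ and $(N_{2}:_{R_{2}}JM_{2})\cap S=\emptyset$, then $(N_{2}:_{M_{2}}J)$ is an $S$-prime submodule of $M_{2}$.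
   Context: Rings are commutative with non-zero identity and modules are unital. A non-empty subset of a ring is multiplicatively closed if it is closed under multiplication. For submodules $N,K$ of an $R$-module $M$, $(N:_{R}K)=\{r\in R: rK\subseteq N\}$; for an ideal $J$ of $R$, $(N:_{M}J)=\{m\in M: Jm\subseteq N\}$. Amalgamation: $R_{1}\Join^{f}J=\{(r,f(r)+j):r\in R_{1},j\in J\}$, a subring of $R_{1}\times R_{2}$. $M_{1}\Join^{\varphi}JM_{2}=\{(m_{1},\varphi(m_{1})+m_{2}):m_{1}\in M_{1},m_{2}\in JM_{2}\}$ is an $(R_{1}\Join^{f}J)$-module with scalar product $(r,f(r)+j)(m_{1},\varphi(m_{1})+m_{2})=(rm_{1},\varphi(rm_{1})+f(r)m_{2}+j\varphi(m_{1})+jm_{2})$. For a submodule $N_{2}$ of $M_{2}$, $\overline{N_{2}}^{\varphi}=\{(m_{1},\varphi(m_{1})+m_{2})\in M_{1}\Join^{\varphi}JM_{2}:\varphi(m_{1})+m_{2}\in N_{2}\}$. For a multiplicatively closed $S\subseteq R_{2}$, $\overline{S}^{\varphi}=\{(r,f(r)+j):r\in R_{1},\ j\in J,\ f(r)+j\in S\}$, a multiplicatively closed subset of $R_{1}\Join^{f}J$. For a multiplicatively closed subset $T$ of a ring $R$, a submodule $N$ of an $R$-module $M$ with $(N:_{R}M)\cap T=\emptyset$ is $T$-prime if there exists a fixed $t\in T$ such that for all $a\in R$, $m\in M$ with $am\in N$, either $ta\in(N:_{R}M)$ or $tm\in N$. *)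

theory Defs
  imports "HOL-Algebra.Algebra"
begin

text \<open>As in the convention "non-empty and closed under multiplication", a multiplicatively
  closed set need not contain the identity.\<close>

definition mult_closed :: "('a, 'm) ring_scheme \<Rightarrow> 'a set \<Rightarrow> bool"
  where "mult_closed R T \<longleftrightarrow>
    T \<noteq> {} \<and> T \<subseteq> carrier R \<and> (\<forall>s\<in>T. \<forall>t\<in>T. s \<otimes>\<^bsub>R\<^esub> t \<in> T)"

text \<open>\<open>colon_ring R M N K\<close> is the residual \<open>(N :\<^sub>R K)\<close> and \<open>colon_mod M N J\<close> is
  \<open>(N :\<^sub>M J)\<close>.\<close>

definition colon_ring ::
    "('a, 'm) ring_scheme \<Rightarrow> ('a, 'b, 'n) module_scheme \<Rightarrow> 'b set \<Rightarrow> 'b set \<Rightarrow> 'a set"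
  where "colon_ring R M N K = {r \<in> carrier R. \<forall>k\<in>K. r \<odot>\<^bsub>M\<^esub> k \<in> N}"

definition colon_mod :: "('a, 'b, 'n) module_scheme \<Rightarrow> 'b set \<Rightarrow> 'a set \<Rightarrow> 'b set"
  where "colon_mod M N J = {m \<in> carrier M. \<forall>j\<in>J. j \<odot>\<^bsub>M\<^esub> m \<in> N}"

definition S_prime_submodule ::
    "('a, 'm) ring_scheme \<Rightarrow> ('a, 'b, 'n) module_scheme \<Rightarrow> 'a set \<Rightarrow> 'b set \<Rightarrow> bool"
  where "S_prime_submodule R M T N \<longleftrightarrow>
    module R M \<and> mult_closed R T \<and> submodule N R M \<and>
    colon_ring R M N (carrier M) \<inter> T = {} \<and>
    (\<exists>t\<in>T. \<forall>a\<in>carrier R. \<forall>m\<in>carrier M. a \<odot>\<^bsub>M\<^esub> m \<in> N \<longrightarrow>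
       t \<otimes>\<^bsub>R\<^esub> a \<in> colon_ring R M N (carrier M) \<or> t \<odot>\<^bsub>M\<^esub> m \<in> N)"

definition restrict_scalars ::
    "('a \<Rightarrow> 'c) \<Rightarrow> ('c, 'b) module \<Rightarrow> ('a, 'b) module"
  where "restrict_scalars f M =
    \<lparr>carrier = carrier M, monoid.mult = monoid.mult M, one = one M, ring.zero = ring.zero M, add = add M,
     smult = (\<lambda>r m. f r \<odot>\<^bsub>M\<^esub> m)\<rparr>"

definition mod_hom ::
    "('a, 'm) ring_scheme \<Rightarrow> ('a, 'b, 'n) module_scheme \<Rightarrow> ('a, 'c, 'k) module_scheme \<Rightarrow> ('b \<Rightarrow> 'c) set"
  where "mod_hom R M N =
    {h \<in> hom (add_monoid M) (add_monoid N).
       \<forall>r\<in>carrier R. \<forall>m\<in>carrier M. h (r \<odot>\<^bsub>M\<^esub> m) = r \<odot>\<^bsub>N\<^esub> h m}"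

text \<open>The submodule \<open>JM\<close>: finite sums of products \<open>jm\<close>. Since \<open>J\<close> is an ideal, the additive
  subgroup generated by these products is the submodule generated by them.\<close>

definition ideal_smult :: "'a set \<Rightarrow> ('a, 'b, 'n) module_scheme \<Rightarrow> 'b set"
  where "ideal_smult J M =
    generate (add_monoid M) {j \<odot>\<^bsub>M\<^esub> m | j m. j \<in> J \<and> m \<in> carrier M}"

definition amalg_ring ::
    "('a, 'm) ring_scheme \<Rightarrow> ('c, 'n) ring_scheme \<Rightarrow> ('a \<Rightarrow> 'c) \<Rightarrow> 'c set \<Rightarrow> ('a \<times> 'c) ring"
  where "amalg_ring R\<^sub>1 R\<^sub>2 f J = (RDirProd R\<^sub>1 R\<^sub>2)
    \<lparr>carrier := {(r, f r \<oplus>\<^bsub>R\<^sub>2\<^esub> j) | r j. r \<in> carrier R\<^sub>1 \<and> j \<in> J}\<rparr>"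

text \<open>The scalar product of \<open>(r, f r + j)\<close> with \<open>(m\<^sub>1, \<phi> m\<^sub>1 + m\<^sub>2)\<close> is given by a formula in
  \<open>r, j, m\<^sub>1, m\<^sub>2\<close>; here \<open>j\<close> and \<open>m\<^sub>2\<close> are recovered from the pairs by subtraction. The fields
  \<open>mult\<close> and \<open>one\<close> of the module record play no role.\<close>

definition amalg_module ::
    "('a, 'm) ring_scheme \<Rightarrow> ('c, 'n) ring_scheme \<Rightarrow> ('a \<Rightarrow> 'c) \<Rightarrow> 'c set \<Rightarrow>
     ('a, 'b, 'k) module_scheme \<Rightarrow> ('c, 'd, 'l) module_scheme \<Rightarrow> ('b \<Rightarrow> 'd) \<Rightarrow>
     ('a \<times> 'c, 'b \<times> 'd) module"
  where "amalg_module R\<^sub>1 R\<^sub>2 f J M\<^sub>1 M\<^sub>2 \<phi> =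
    \<lparr>carrier = {(m\<^sub>1, \<phi> m\<^sub>1 \<oplus>\<^bsub>M\<^sub>2\<^esub> m\<^sub>2) | m\<^sub>1 m\<^sub>2. m\<^sub>1 \<in> carrier M\<^sub>1 \<and> m\<^sub>2 \<in> ideal_smult J M\<^sub>2},
     monoid.mult = undefined, one = undefined,
     ring.zero = (\<zero>\<^bsub>M\<^sub>1\<^esub>, \<zero>\<^bsub>M\<^sub>2\<^esub>),
     add = (\<lambda>(x, y) (x', y'). (x \<oplus>\<^bsub>M\<^sub>1\<^esub> x', y \<oplus>\<^bsub>M\<^sub>2\<^esub> y')),
     smult = (\<lambda>(r, s) (m\<^sub>1, y).
       let j = s \<ominus>\<^bsub>R\<^sub>2\<^esub> f r; m\<^sub>2 = y \<ominus>\<^bsub>M\<^sub>2\<^esub> \<phi> m\<^sub>1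
       in (r \<odot>\<^bsub>M\<^sub>1\<^esub> m\<^sub>1,
           \<phi> (r \<odot>\<^bsub>M\<^sub>1\<^esub> m\<^sub>1) \<oplus>\<^bsub>M\<^sub>2\<^esub> f r \<odot>\<^bsub>M\<^sub>2\<^esub> m\<^sub>2 \<oplus>\<^bsub>M\<^sub>2\<^esub> j \<odot>\<^bsub>M\<^sub>2\<^esub> \<phi> m\<^sub>1 \<oplus>\<^bsub>M\<^sub>2\<^esub> j \<odot>\<^bsub>M\<^sub>2\<^esub> m\<^sub>2))\<rparr>"

definition amalg_submodule ::
    "'c set \<Rightarrow> ('a, 'b, 'k) module_scheme \<Rightarrow> ('c, 'd, 'l) module_scheme \<Rightarrow> ('b \<Rightarrow> 'd) \<Rightarrow>
     'd set \<Rightarrow> ('b \<times> 'd) set"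
  where "amalg_submodule J M\<^sub>1 M\<^sub>2 \<phi> N\<^sub>2 =
    {(m\<^sub>1, \<phi> m\<^sub>1 \<oplus>\<^bsub>M\<^sub>2\<^esub> m\<^sub>2) | m\<^sub>1 m\<^sub>2. m\<^sub>1 \<in> carrier M\<^sub>1 \<and> m\<^sub>2 \<in> ideal_smult J M\<^sub>2 \<and>
       \<phi> m\<^sub>1 \<oplus>\<^bsub>M\<^sub>2\<^esub> m\<^sub>2 \<in> N\<^sub>2}"

definition amalg_mult_set ::
    "('a, 'm) ring_scheme \<Rightarrow> ('c, 'n) ring_scheme \<Rightarrow> ('a \<Rightarrow> 'c) \<Rightarrow> 'c set \<Rightarrow> 'c set \<Rightarrow> ('a \<times> 'c) set"
  where "amalg_mult_set R\<^sub>1 R\<^sub>2 f J S =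
    {(r, f r \<oplus>\<^bsub>R\<^sub>2\<^esub> j) | r j. r \<in> carrier R\<^sub>1 \<and> j \<in> J \<and> f r \<oplus>\<^bsub>R\<^sub>2\<^esub> j \<in> S}"

text \<open>Well-definedness: the amalgamation is a commutative ring, the scalar product satisfies its
  defining formula and is in fact componentwise, and the amalgamated module is a module.\<close>

locale amalgamation =
  R1: cring R\<^sub>1 + R2: cring R\<^sub>2 + M1: module R\<^sub>1 M\<^sub>1 + M2: module R\<^sub>2 M\<^sub>2
  for R\<^sub>1 :: "'a ring" and R\<^sub>2 :: "'c ring"
    and M\<^sub>1 :: "('a, 'b) module" and M\<^sub>2 :: "('c, 'd) module" +
  fixes f :: "'a \<Rightarrow> 'c" and J :: "'c set" and \<phi> :: "'b \<Rightarrow> 'd"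
  assumes f: "f \<in> ring_hom R\<^sub>1 R\<^sub>2"
    and J: "ideal J R\<^sub>2"
    and phi: "\<phi> \<in> mod_hom R\<^sub>1 M\<^sub>1 (restrict_scalars f M\<^sub>2)"
begin

abbreviation "RR \<equiv> amalg_ring R\<^sub>1 R\<^sub>2 f J"
abbreviation "MM \<equiv> amalg_module R\<^sub>1 R\<^sub>2 f J M\<^sub>1 M\<^sub>2 \<phi>"
abbreviation "JM \<equiv> ideal_smult J M\<^sub>2"

sublocale f: ring_hom_cring R\<^sub>1 R\<^sub>2 f
  by unfold_locales (rule f)

sublocale J: ideal J R\<^sub>2
  by (rule J)

lemma phi_closed [simp]: "x \<in> carrier M\<^sub>1 \<Longrightarrow> \<phi> x \<in> carrier M\<^sub>2"
  and phi_add: "x \<in> carrier M\<^sub>1 \<Longrightarrow> y \<in> carrier M\<^sub>1 \<Longrightarrow> \<phi> (x \<oplus>\<^bsub>M\<^sub>1\<^esub> y) = \<phi> x \<oplus>\<^bsub>M\<^sub>2\<^esub> \<phi> y"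
  and phi_smult: "r \<in> carrier R\<^sub>1 \<Longrightarrow> x \<in> carrier M\<^sub>1 \<Longrightarrow> \<phi> (r \<odot>\<^bsub>M\<^sub>1\<^esub> x) = f r \<odot>\<^bsub>M\<^sub>2\<^esub> \<phi> x"
  using phi by (auto simp: mod_hom_def restrict_scalars_def hom_def)

lemma phi_zero: "\<phi> \<zero>\<^bsub>M\<^sub>1\<^esub> = \<zero>\<^bsub>M\<^sub>2\<^esub>"
  using phi_smult[of "\<zero>\<^bsub>R\<^sub>1\<^esub>" "\<zero>\<^bsub>M\<^sub>1\<^esub>"] by simp

lemma JM_submodule: "submodule JM R\<^sub>2 M\<^sub>2"
proof -
  let ?G = "{j \<odot>\<^bsub>M\<^sub>2\<^esub> m | j m. j \<in> J \<and> m \<in> carrier M\<^sub>2}"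
  have G: "?G \<subseteq> carrier M\<^sub>2" using J.Icarr by auto
  have A: "group (add_monoid M\<^sub>2)" by (rule M2.a_group)
  have sg: "subgroup JM (add_monoid M\<^sub>2)"
    unfolding ideal_smult_def using group.generate_is_subgroup[OF A, of ?G] G by simp
  have "a \<odot>\<^bsub>M\<^sub>2\<^esub> x \<in> JM" if a: "a \<in> carrier R\<^sub>2" and x: "x \<in> JM" for a x
    using x unfolding ideal_smult_def
  proof (induction rule: generate.induct)
    case one
    then show ?case using a generate.one[of "add_monoid M\<^sub>2"] by simp
  next
    case (incl h)
    then obtain j m where h: "h = j \<odot>\<^bsub>M\<^sub>2\<^esub> m" "j \<in> J" "m \<in> carrier M\<^sub>2" by auto
    then have "a \<odot>\<^bsub>M\<^sub>2\<^esub> h = (a \<otimes>\<^bsub>R\<^sub>2\<^esub> j) \<odot>\<^bsub>M\<^sub>2\<^esub> m"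
      using a J.Icarr by (simp add: M2.smult_assoc1)
    then show ?case using h a J.I_l_closed by (auto intro!: generate.incl)
  next
    case (inv h)
    then obtain j m where h: "h = j \<odot>\<^bsub>M\<^sub>2\<^esub> m" "j \<in> J" "m \<in> carrier M\<^sub>2" by auto
    have "a \<odot>\<^bsub>M\<^sub>2\<^esub> (inv\<^bsub>add_monoid M\<^sub>2\<^esub> h) = \<ominus>\<^bsub>M\<^sub>2\<^esub> ((a \<otimes>\<^bsub>R\<^sub>2\<^esub> j) \<odot>\<^bsub>M\<^sub>2\<^esub> m)"
      using h a J.Icarr M2.smult_r_minus[of a h] by (simp add: M2.smult_assoc1 a_inv_def)
    moreover have "(a \<otimes>\<^bsub>R\<^sub>2\<^esub> j) \<odot>\<^bsub>M\<^sub>2\<^esub> m \<in> ?G" using h a J.I_l_closed by auto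
    ultimately show ?case by (simp add: a_inv_def generate.inv)
  next
    case (eng h1 h2)
    then have "h1 \<in> carrier M\<^sub>2" "h2 \<in> carrier M\<^sub>2"
      using group.generate_in_carrier[OF A, of ?G] G by auto
    then show ?case
      using eng a generate.eng[OF eng.IH] by (simp add: M2.smult_r_distr)
  qed
  then show ?thesis using sg by (simp add: submodule_def submodule_axioms_def)
qed

lemmas JM = M2.submoduleE[OF JM_submodule]

lemma JM_carrier: "x \<in> JM \<Longrightarrow> x \<in> carrier M\<^sub>2"
  using JM(1) by auto

lemma JM_smult: "j \<in> J \<Longrightarrow> m \<in> carrier M\<^sub>2 \<Longrightarrow> j \<odot>\<^bsub>M\<^sub>2\<^esub> m \<in> JM"
  unfolding ideal_smult_def by (auto intro!: generate.incl)

lemma RR_carrier_iff: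
  "(r, s) \<in> carrier RR \<longleftrightarrow> r \<in> carrier R\<^sub>1 \<and> s \<in> carrier R\<^sub>2 \<and> s \<ominus>\<^bsub>R\<^sub>2\<^esub> f r \<in> J"
proof
  assume "(r, s) \<in> carrier RR"
  then obtain j where j: "s = f r \<oplus>\<^bsub>R\<^sub>2\<^esub> j" "r \<in> carrier R\<^sub>1" "j \<in> J"
    by (auto simp: amalg_ring_def)
  then have "j \<in> carrier R\<^sub>2" "f r \<in> carrier R\<^sub>2" using J.Icarr by auto
  then have "s \<ominus>\<^bsub>R\<^sub>2\<^esub> f r = j" unfolding j by algebra
  then show "r \<in> carrier R\<^sub>1 \<and> s \<in> carrier R\<^sub>2 \<and> s \<ominus>\<^bsub>R\<^sub>2\<^esub> f r \<in> J"
    using j J.Icarr by auto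
next
  assume a: "r \<in> carrier R\<^sub>1 \<and> s \<in> carrier R\<^sub>2 \<and> s \<ominus>\<^bsub>R\<^sub>2\<^esub> f r \<in> J"
  then have "s \<in> carrier R\<^sub>2" "f r \<in> carrier R\<^sub>2" by auto
  then have "s = f r \<oplus>\<^bsub>R\<^sub>2\<^esub> (s \<ominus>\<^bsub>R\<^sub>2\<^esub> f r)" by algebra
  with a show "(r, s) \<in> carrier RR" by (auto simp: amalg_ring_def)
qed

lemma M2_minus_eq_iff:
  assumes "x \<in> carrier M\<^sub>2" "y \<in> carrier M\<^sub>2" "z \<in> carrier M\<^sub>2"
  shows "y = x \<oplus>\<^bsub>M\<^sub>2\<^esub> z \<longleftrightarrow> y \<ominus>\<^bsub>M\<^sub>2\<^esub> x = z"
  using assms M2.a_comm M2.minus_eq M2.add.inv_solve_right[of z y x]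
  by (auto simp: a_inv_def a_minus_def)

lemma MM_carrier_iff:
  "(x, y) \<in> carrier MM \<longleftrightarrow> x \<in> carrier M\<^sub>1 \<and> y \<in> carrier M\<^sub>2 \<and> y \<ominus>\<^bsub>M\<^sub>2\<^esub> \<phi> x \<in> JM"
proof
  assume "(x, y) \<in> carrier MM"
  then obtain m where m: "y = \<phi> x \<oplus>\<^bsub>M\<^sub>2\<^esub> m" "x \<in> carrier M\<^sub>1" "m \<in> JM"
    by (auto simp: amalg_module_def)
  then show "x \<in> carrier M\<^sub>1 \<and> y \<in> carrier M\<^sub>2 \<and> y \<ominus>\<^bsub>M\<^sub>2\<^esub> \<phi> x \<in> JM"
    using JM_carrier M2_minus_eq_iff[of "\<phi> x" y m] by auto
next
  assume a: "x \<in> carrier M\<^sub>1 \<and> y \<in> carrier M\<^sub>2 \<and> y \<ominus>\<^bsub>M\<^sub>2\<^esub> \<phi> x \<in> JM"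
  then have "y = \<phi> x \<oplus>\<^bsub>M\<^sub>2\<^esub> (y \<ominus>\<^bsub>M\<^sub>2\<^esub> \<phi> x)"
    using M2_minus_eq_iff[of "\<phi> x" y "y \<ominus>\<^bsub>M\<^sub>2\<^esub> \<phi> x"] JM_carrier by auto
  with a show "(x, y) \<in> carrier MM" by (auto simp: amalg_module_def)
qed

lemma MM_smult_formula:
  assumes "r \<in> carrier R\<^sub>1" "j \<in> J" "m\<^sub>1 \<in> carrier M\<^sub>1" "m\<^sub>2 \<in> JM"
  shows "(r, f r \<oplus>\<^bsub>R\<^sub>2\<^esub> j) \<odot>\<^bsub>MM\<^esub> (m\<^sub>1, \<phi> m\<^sub>1 \<oplus>\<^bsub>M\<^sub>2\<^esub> m\<^sub>2) =
    (r \<odot>\<^bsub>M\<^sub>1\<^esub> m\<^sub>1,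
     \<phi> (r \<odot>\<^bsub>M\<^sub>1\<^esub> m\<^sub>1) \<oplus>\<^bsub>M\<^sub>2\<^esub> f r \<odot>\<^bsub>M\<^sub>2\<^esub> m\<^sub>2 \<oplus>\<^bsub>M\<^sub>2\<^esub> j \<odot>\<^bsub>M\<^sub>2\<^esub> \<phi> m\<^sub>1 \<oplus>\<^bsub>M\<^sub>2\<^esub> j \<odot>\<^bsub>M\<^sub>2\<^esub> m\<^sub>2)"
proof -
  have "j \<in> carrier R\<^sub>2" "f r \<in> carrier R\<^sub>2" using assms J.Icarr by auto
  then have "(f r \<oplus>\<^bsub>R\<^sub>2\<^esub> j) \<ominus>\<^bsub>R\<^sub>2\<^esub> f r = j" by algebra
  moreover have "(\<phi> m\<^sub>1 \<oplus>\<^bsub>M\<^sub>2\<^esub> m\<^sub>2) \<ominus>\<^bsub>M\<^sub>2\<^esub> \<phi> m\<^sub>1 = m\<^sub>2"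
    using M2_minus_eq_iff[of "\<phi> m\<^sub>1" "\<phi> m\<^sub>1 \<oplus>\<^bsub>M\<^sub>2\<^esub> m\<^sub>2" m\<^sub>2] assms JM_carrier by auto
  ultimately show ?thesis by (simp add: amalg_module_def)
qed

lemma MM_smult:
  assumes "(r, s) \<in> carrier RR" "(x, y) \<in> carrier MM"
  shows "(r, s) \<odot>\<^bsub>MM\<^esub> (x, y) = (r \<odot>\<^bsub>M\<^sub>1\<^esub> x, s \<odot>\<^bsub>M\<^sub>2\<^esub> y)"
proof -
  from assms(1) obtain j where j: "s = f r \<oplus>\<^bsub>R\<^sub>2\<^esub> j" "r \<in> carrier R\<^sub>1" "j \<in> J"
    by (auto simp: amalg_ring_def)
  from assms(2) obtain m where m: "y = \<phi> x \<oplus>\<^bsub>M\<^sub>2\<^esub> m" "x \<in> carrier M\<^sub>1" "m \<in> JM"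
    by (auto simp: amalg_module_def)
  have c: "j \<in> carrier R\<^sub>2" "m \<in> carrier M\<^sub>2" using j m J.Icarr JM_carrier by auto
  have "s \<odot>\<^bsub>M\<^sub>2\<^esub> y = f r \<odot>\<^bsub>M\<^sub>2\<^esub> \<phi> x \<oplus>\<^bsub>M\<^sub>2\<^esub> f r \<odot>\<^bsub>M\<^sub>2\<^esub> m \<oplus>\<^bsub>M\<^sub>2\<^esub> j \<odot>\<^bsub>M\<^sub>2\<^esub> \<phi> x \<oplus>\<^bsub>M\<^sub>2\<^esub> j \<odot>\<^bsub>M\<^sub>2\<^esub> m"
    using c j m by (simp add: M2.smult_l_distr M2.smult_r_distr M2.a_ac)
  then show ?thesis using MM_smult_formula[of r j x m] j m by (simp add: phi_smult)
qed

lemma RR_cring: "cring RR"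
proof -
  interpret P: ring "RDirProd R\<^sub>1 R\<^sub>2"
    by (intro RDirProd_ring R1.ring_axioms R2.ring_axioms)
  have ops: "\<And>a b c d. (a, b) \<otimes>\<^bsub>RDirProd R\<^sub>1 R\<^sub>2\<^esub> (c, d) = (a \<otimes>\<^bsub>R\<^sub>1\<^esub> c, b \<otimes>\<^bsub>R\<^sub>2\<^esub> d)"
    "\<And>a b c d. (a, b) \<oplus>\<^bsub>RDirProd R\<^sub>1 R\<^sub>2\<^esub> (c, d) = (a \<oplus>\<^bsub>R\<^sub>1\<^esub> c, b \<oplus>\<^bsub>R\<^sub>2\<^esub> d)"
    "\<one>\<^bsub>RDirProd R\<^sub>1 R\<^sub>2\<^esub> = (\<one>\<^bsub>R\<^sub>1\<^esub>, \<one>\<^bsub>R\<^sub>2\<^esub>)"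
    "\<zero>\<^bsub>RDirProd R\<^sub>1 R\<^sub>2\<^esub> = (\<zero>\<^bsub>R\<^sub>1\<^esub>, \<zero>\<^bsub>R\<^sub>2\<^esub>)"
    by (simp_all add: RDirProd_def DirProd_def monoid.defs)
  have neg: "\<ominus>\<^bsub>RDirProd R\<^sub>1 R\<^sub>2\<^esub> (a, b) = (\<ominus>\<^bsub>R\<^sub>1\<^esub> a, \<ominus>\<^bsub>R\<^sub>2\<^esub> b)"
    if "a \<in> carrier R\<^sub>1" "b \<in> carrier R\<^sub>2" for a b
    by (rule P.minus_equality)
       (use that in \<open>auto simp: ops RDirProd_carrier R1.l_neg R2.l_neg\<close>)
  have "subcring (carrier RR) (RDirProd R\<^sub>1 R\<^sub>2)"
  proof (rule P.subcringI[OF P.subringI])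
    show "carrier RR \<subseteq> carrier (RDirProd R\<^sub>1 R\<^sub>2)"
      by (auto simp: RR_carrier_iff RDirProd_carrier)
    show "\<one>\<^bsub>RDirProd R\<^sub>1 R\<^sub>2\<^esub> \<in> carrier RR"
      by (simp add: ops RR_carrier_iff a_minus_def R2.r_neg)
  next
    fix h assume h: "h \<in> carrier RR"
    obtain r s where rs: "h = (r, s)" by force
    have c: "r \<in> carrier R\<^sub>1" "s \<in> carrier R\<^sub>2" "f r \<in> carrier R\<^sub>2" "s \<ominus>\<^bsub>R\<^sub>2\<^esub> f r \<in> J"
      using h by (auto simp: rs RR_carrier_iff)
    have "\<ominus>\<^bsub>R\<^sub>2\<^esub> s \<ominus>\<^bsub>R\<^sub>2\<^esub> (\<ominus>\<^bsub>R\<^sub>2\<^esub> f r) = \<ominus>\<^bsub>R\<^sub>2\<^esub> (s \<ominus>\<^bsub>R\<^sub>2\<^esub> f r)" using c by algebra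
    then show "\<ominus>\<^bsub>RDirProd R\<^sub>1 R\<^sub>2\<^esub> h \<in> carrier RR"
      using c J.a_inv_closed by (simp add: rs neg RR_carrier_iff)
  next
    fix h h' assume h: "h \<in> carrier RR" "h' \<in> carrier RR"
    obtain r s r' s' where rs: "h = (r, s)" "h' = (r', s')" by force
    have c: "r \<in> carrier R\<^sub>1" "s \<in> carrier R\<^sub>2" "f r \<in> carrier R\<^sub>2" "s \<ominus>\<^bsub>R\<^sub>2\<^esub> f r \<in> J"
      "r' \<in> carrier R\<^sub>1" "s' \<in> carrier R\<^sub>2" "f r' \<in> carrier R\<^sub>2" "s' \<ominus>\<^bsub>R\<^sub>2\<^esub> f r' \<in> J"
      using h by (auto simp: rs RR_carrier_iff)
    have "(s \<otimes>\<^bsub>R\<^sub>2\<^esub> s') \<ominus>\<^bsub>R\<^sub>2\<^esub> (f r \<otimes>\<^bsub>R\<^sub>2\<^esub> f r') =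
        s' \<otimes>\<^bsub>R\<^sub>2\<^esub> (s \<ominus>\<^bsub>R\<^sub>2\<^esub> f r) \<oplus>\<^bsub>R\<^sub>2\<^esub> f r \<otimes>\<^bsub>R\<^sub>2\<^esub> (s' \<ominus>\<^bsub>R\<^sub>2\<^esub> f r')"
      using c by algebra
    also have "\<dots> \<in> J" using c J.I_l_closed J.a_closed by blast
    finally show "h \<otimes>\<^bsub>RDirProd R\<^sub>1 R\<^sub>2\<^esub> h' \<in> carrier RR"
      using c by (simp add: rs ops RR_carrier_iff)
    have "(s \<oplus>\<^bsub>R\<^sub>2\<^esub> s') \<ominus>\<^bsub>R\<^sub>2\<^esub> (f r \<oplus>\<^bsub>R\<^sub>2\<^esub> f r') = (s \<ominus>\<^bsub>R\<^sub>2\<^esub> f r) \<oplus>\<^bsub>R\<^sub>2\<^esub> (s' \<ominus>\<^bsub>R\<^sub>2\<^esub> f r')"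
      using c by algebra
    also have "\<dots> \<in> J" using c J.a_closed by blast
    finally show "h \<oplus>\<^bsub>RDirProd R\<^sub>1 R\<^sub>2\<^esub> h' \<in> carrier RR"
      using c by (simp add: rs ops RR_carrier_iff)
    show "h \<otimes>\<^bsub>RDirProd R\<^sub>1 R\<^sub>2\<^esub> h' = h' \<otimes>\<^bsub>RDirProd R\<^sub>1 R\<^sub>2\<^esub> h"
      using c by (simp add: rs ops R1.m_comm R2.m_comm)
  qed
  then have "cring ((RDirProd R\<^sub>1 R\<^sub>2)\<lparr>carrier := carrier RR\<rparr>)"
    by (rule P.subcring_iff[THEN iffD1, rotated])
       (auto simp: RR_carrier_iff RDirProd_carrier)
  then show ?thesis by (simp add: amalg_ring_def)
qed

lemma MM_add: "(x, y) \<oplus>\<^bsub>MM\<^esub> (x', y') = (x \<oplus>\<^bsub>M\<^sub>1\<^esub> x', y \<oplus>\<^bsub>M\<^sub>2\<^esub> y')"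
  and MM_zero: "\<zero>\<^bsub>MM\<^esub> = (\<zero>\<^bsub>M\<^sub>1\<^esub>, \<zero>\<^bsub>M\<^sub>2\<^esub>)"
  by (simp_all add: amalg_module_def)

lemma RR_ops:
  "(r, s) \<oplus>\<^bsub>RR\<^esub> (r', s') = (r \<oplus>\<^bsub>R\<^sub>1\<^esub> r', s \<oplus>\<^bsub>R\<^sub>2\<^esub> s')"
  "(r, s) \<otimes>\<^bsub>RR\<^esub> (r', s') = (r \<otimes>\<^bsub>R\<^sub>1\<^esub> r', s \<otimes>\<^bsub>R\<^sub>2\<^esub> s')"
  "\<one>\<^bsub>RR\<^esub> = (\<one>\<^bsub>R\<^sub>1\<^esub>, \<one>\<^bsub>R\<^sub>2\<^esub>)"
  by (simp_all add: amalg_ring_def RDirProd_def DirProd_def monoid.defs)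

lemma MM_carrierE:
  assumes "p \<in> carrier MM"
  obtains x m where "p = (x, \<phi> x \<oplus>\<^bsub>M\<^sub>2\<^esub> m)" "x \<in> carrier M\<^sub>1" "m \<in> JM" "m \<in> carrier M\<^sub>2"
  using assms JM_carrier by (auto simp: amalg_module_def)

lemma MM_carrierI:
  assumes "x \<in> carrier M\<^sub>1" "m \<in> JM" "y = \<phi> x \<oplus>\<^bsub>M\<^sub>2\<^esub> m"
  shows "(x, y) \<in> carrier MM"
  using assms by (auto simp: amalg_module_def)

lemma MM_abelian_group: "abelian_group MM"
proof (rule abelian_groupI)
  fix p q assume p: "p \<in> carrier MM" and q: "q \<in> carrier MM"
  from p obtain x m where x: "p = (x, \<phi> x \<oplus>\<^bsub>M\<^sub>2\<^esub> m)" "x \<in> carrier M\<^sub>1" "m \<in> JM" "m \<in> carrier M\<^sub>2"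
    by (rule MM_carrierE)
  from q obtain y n where y: "q = (y, \<phi> y \<oplus>\<^bsub>M\<^sub>2\<^esub> n)" "y \<in> carrier M\<^sub>1" "n \<in> JM" "n \<in> carrier M\<^sub>2"
    by (rule MM_carrierE)
  show "p \<oplus>\<^bsub>MM\<^esub> q \<in> carrier MM"
    using x y JM(5)[of m n]
    by (auto simp: MM_add phi_add M2.a_ac intro!: MM_carrierI[of _ "m \<oplus>\<^bsub>M\<^sub>2\<^esub> n"])
  show "p \<oplus>\<^bsub>MM\<^esub> q = q \<oplus>\<^bsub>MM\<^esub> p"
    using x y by (simp add: MM_add M1.a_comm M2.a_comm)
  fix l assume "l \<in> carrier MM"
  then obtain z k where z: "l = (z, \<phi> z \<oplus>\<^bsub>M\<^sub>2\<^esub> k)" "z \<in> carrier M\<^sub>1" "k \<in> carrier M\<^sub>2"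
    by (rule MM_carrierE)
  show "p \<oplus>\<^bsub>MM\<^esub> q \<oplus>\<^bsub>MM\<^esub> l = p \<oplus>\<^bsub>MM\<^esub> (q \<oplus>\<^bsub>MM\<^esub> l)"
    using x y z by (simp add: MM_add M1.a_assoc M2.a_assoc)
next
  show "\<zero>\<^bsub>MM\<^esub> \<in> carrier MM"
    using submodule.axioms(1)[OF JM_submodule, THEN subgroup.one_closed]
    by (auto simp: MM_zero phi_zero intro!: MM_carrierI[of _ "\<zero>\<^bsub>M\<^sub>2\<^esub>"])
next
  fix p assume p: "p \<in> carrier MM"
  then obtain x m where x: "p = (x, \<phi> x \<oplus>\<^bsub>M\<^sub>2\<^esub> m)" "x \<in> carrier M\<^sub>1" "m \<in> JM" "m \<in> carrier M\<^sub>2"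
    by (rule MM_carrierE)
  show "\<zero>\<^bsub>MM\<^esub> \<oplus>\<^bsub>MM\<^esub> p = p" using x by (simp add: MM_add MM_zero)
  have "\<phi> (\<ominus>\<^bsub>M\<^sub>1\<^esub> x) \<oplus>\<^bsub>M\<^sub>2\<^esub> \<phi> x = \<zero>\<^bsub>M\<^sub>2\<^esub>"
    using x phi_add[of "\<ominus>\<^bsub>M\<^sub>1\<^esub> x" x] by (simp add: M1.l_neg phi_zero)
  then have phi_neg: "\<phi> (\<ominus>\<^bsub>M\<^sub>1\<^esub> x) = \<ominus>\<^bsub>M\<^sub>2\<^esub> \<phi> x"
    using x M2.minus_equality by auto
  have "(\<ominus>\<^bsub>M\<^sub>1\<^esub> x, \<ominus>\<^bsub>M\<^sub>2\<^esub> (\<phi> x \<oplus>\<^bsub>M\<^sub>2\<^esub> m)) \<in> carrier MM"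
    using x JM(3)[of m] by (auto simp: phi_neg M2.minus_add intro!: MM_carrierI[of _ "\<ominus>\<^bsub>M\<^sub>2\<^esub> m"])
  moreover have "(\<ominus>\<^bsub>M\<^sub>1\<^esub> x, \<ominus>\<^bsub>M\<^sub>2\<^esub> (\<phi> x \<oplus>\<^bsub>M\<^sub>2\<^esub> m)) \<oplus>\<^bsub>MM\<^esub> p = \<zero>\<^bsub>MM\<^esub>"
    using x by (simp add: MM_add MM_zero M1.l_neg M2.l_neg)
  ultimately show "\<exists>q\<in>carrier MM. q \<oplus>\<^bsub>MM\<^esub> p = \<zero>\<^bsub>MM\<^esub>" by blast
qed

lemma MM_smult_closed:
  assumes "a \<in> carrier RR" "p \<in> carrier MM"
  shows "a \<odot>\<^bsub>MM\<^esub> p \<in> carrier MM"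
proof -
  from assms(1) obtain r j where j: "a = (r, f r \<oplus>\<^bsub>R\<^sub>2\<^esub> j)" "r \<in> carrier R\<^sub>1" "j \<in> J"
    by (auto simp: amalg_ring_def)
  from assms(2) obtain x m where m: "p = (x, \<phi> x \<oplus>\<^bsub>M\<^sub>2\<^esub> m)" "x \<in> carrier M\<^sub>1" "m \<in> JM" "m \<in> carrier M\<^sub>2"
    by (rule MM_carrierE)
  have "j \<in> carrier R\<^sub>2" using j J.Icarr by auto
  moreover have "f r \<odot>\<^bsub>M\<^sub>2\<^esub> m \<oplus>\<^bsub>M\<^sub>2\<^esub> (j \<odot>\<^bsub>M\<^sub>2\<^esub> \<phi> x \<oplus>\<^bsub>M\<^sub>2\<^esub> j \<odot>\<^bsub>M\<^sub>2\<^esub> m) \<in> JM"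
    using j m by (intro JM(4,5) JM_smult) auto
  ultimately show ?thesis
    unfolding j(1) m(1) using j m
    by (subst MM_smult_formula) (auto intro!: MM_carrierI simp: M2.a_assoc)
qed

lemma MM_module: "module RR MM"
proof (rule moduleI[OF RR_cring MM_abelian_group])
  interpret RR: cring RR by (rule RR_cring)
  interpret MM: abelian_group MM by (rule MM_abelian_group)
  fix a p assume a: "a \<in> carrier RR" and p: "p \<in> carrier MM"
  then show "a \<odot>\<^bsub>MM\<^esub> p \<in> carrier MM" by (rule MM_smult_closed)
  obtain r s where rs: "a = (r, s)" by force
  obtain x y where xy: "p = (x, y)" by force
  have c: "r \<in> carrier R\<^sub>1" "s \<in> carrier R\<^sub>2" "x \<in> carrier M\<^sub>1" "y \<in> carrier M\<^sub>2"
    using a p by (auto simp: rs xy RR_carrier_iff MM_carrier_iff)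
  {
    fix b assume b: "b \<in> carrier RR"
    obtain r' s' where rs': "b = (r', s')" by force
    have c': "r' \<in> carrier R\<^sub>1" "s' \<in> carrier R\<^sub>2" using b by (auto simp: rs' RR_carrier_iff)
    have ab: "(r \<oplus>\<^bsub>R\<^sub>1\<^esub> r', s \<oplus>\<^bsub>R\<^sub>2\<^esub> s') \<in> carrier RR" "(r \<otimes>\<^bsub>R\<^sub>1\<^esub> r', s \<otimes>\<^bsub>R\<^sub>2\<^esub> s') \<in> carrier RR"
      using RR.a_closed[OF a b] RR.m_closed[OF a b] by (simp_all add: rs rs' RR_ops)
    have bp: "(r' \<odot>\<^bsub>M\<^sub>1\<^esub> x, s' \<odot>\<^bsub>M\<^sub>2\<^esub> y) \<in> carrier MM"
      using MM_smult_closed[OF b p] b p by (simp add: rs' xy MM_smult)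
    show "(a \<oplus>\<^bsub>RR\<^esub> b) \<odot>\<^bsub>MM\<^esub> p = a \<odot>\<^bsub>MM\<^esub> p \<oplus>\<^bsub>MM\<^esub> b \<odot>\<^bsub>MM\<^esub> p"
      using a b p ab c c'
      by (simp add: rs rs' xy RR_ops MM_add MM_smult M1.smult_l_distr M2.smult_l_distr)
    show "(a \<otimes>\<^bsub>RR\<^esub> b) \<odot>\<^bsub>MM\<^esub> p = a \<odot>\<^bsub>MM\<^esub> (b \<odot>\<^bsub>MM\<^esub> p)"
      using a b p ab bp c c'
      by (simp add: rs rs' xy RR_ops MM_smult M1.smult_assoc1 M2.smult_assoc1)
  }
  fix q assume q: "q \<in> carrier MM"
  obtain x' y' where xy': "q = (x', y')" by force
  have c': "x' \<in> carrier M\<^sub>1" "y' \<in> carrier M\<^sub>2" using q by (auto simp: xy' MM_carrier_iff)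
  have "(x \<oplus>\<^bsub>M\<^sub>1\<^esub> x', y \<oplus>\<^bsub>M\<^sub>2\<^esub> y') \<in> carrier MM"
    using MM.a_closed[OF p q] by (simp add: xy xy' MM_add)
  then show "a \<odot>\<^bsub>MM\<^esub> (p \<oplus>\<^bsub>MM\<^esub> q) = a \<odot>\<^bsub>MM\<^esub> p \<oplus>\<^bsub>MM\<^esub> a \<odot>\<^bsub>MM\<^esub> q"
    using a p q c c'
    by (simp add: rs xy xy' MM_add MM_smult M1.smult_r_distr M2.smult_r_distr)
next
  interpret RR: cring RR by (rule RR_cring)
  fix p assume p: "p \<in> carrier MM"
  obtain x y where xy: "p = (x, y)" by force
  have "(\<one>\<^bsub>R\<^sub>1\<^esub>, \<one>\<^bsub>R\<^sub>2\<^esub>) \<in> carrier RR" using RR.one_closed by (simp add: RR_ops)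
  then show "\<one>\<^bsub>RR\<^esub> \<odot>\<^bsub>MM\<^esub> p = p"
    using p by (simp add: xy RR_ops MM_smult) (simp add: MM_carrier_iff)
qed

end

end

theory Submission
  imports Defs
begin

text \<open>The second projections \<open>(r, s) \<mapsto> s\<close> of \<open>R\<^sub>1 \<Join>\<^sup>f J\<close> onto \<open>R\<^sub>2\<close> and \<open>(x, y) \<mapsto> y\<close> of
  \<open>M\<^sub>1 \<Join>\<^sup>\<phi> JM\<^sub>2\<close> onto \<open>M\<^sub>2\<close> are compatible with the scalar products, because the scalar product of the
  amalgamated module is componentwise. They are surjective because \<open>f\<close> and \<open>\<phi>\<close> are: \<open>(r, f r)\<close> and
  \<open>(x, \<phi> x)\<close> already belong to the amalgamations. The sets \<open>S\<close> and \<open>N\<^sub>2\<close> with a bar are the preimages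
  of \<open>S\<close> and \<open>N\<^sub>2\<close> under these projections. So part (1) is the general fact that primeness relative
  to a multiplicatively closed set can be tested after pulling everything back along a surjective
  semilinear map (\<open>S_prime_submodule_vimage_iff\<close>).

  By part (1), the hypothesis of part (2) says that \<open>N\<^sub>2\<close> is \<open>S\<close>-prime. If \<open>a m\<close> lies in
  \<open>(N\<^sub>2 : J)\<close>, then every \<open>a (j m)\<close> lies in \<open>N\<^sub>2\<close>, so primeness of \<open>N\<^sub>2\<close> can be applied to all
  \<open>j m\<close> at once with the same element \<open>t\<close> (\<open>S_prime_submodule_colon_mod\<close>).\<close>

text \<open>The primeness condition speaks only of elements and memberships, so each quantifier over the
  domain can be exchanged for one over the codomain by surjectivity of \<open>g\<close> and \<open>h\<close>.\<close>

lemma S_prime_submodule_vimage_iff: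
  fixes R (structure) and R' (structure)
  assumes M: "module R M" and M': "module R' M'"
    and g: "g \<in> ring_hom R R'" and g_onto: "g ` carrier R = carrier R'"
    and h: "h \<in> hom (add_monoid M) (add_monoid M')" and h_onto: "h ` carrier M = carrier M'"
    and h_smult: "\<And>a m. a \<in> carrier R \<Longrightarrow> m \<in> carrier M \<Longrightarrow> h (a \<odot>\<^bsub>M\<^esub> m) = g a \<odot>\<^bsub>M'\<^esub> h m"
    and T: "mult_closed R' T" and N: "submodule N R' M'"
  shows "S_prime_submodule R' M' T N \<longleftrightarrow>
    S_prime_submodule R M {a \<in> carrier R. g a \<in> T} {m \<in> carrier M. h m \<in> N}"
proof -
  interpret M: module R M by (rule M)
  interpret M': module R' M' by (rule M')
  interpret h: group_hom "add_monoid M" "add_monoid M'" h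
    using h M.a_group M'.a_group by (simp add: group_hom_def group_hom_axioms_def)
  let ?T = "{a \<in> carrier R. g a \<in> T}" and ?N = "{m \<in> carrier M. h m \<in> N}"
  have T': "mult_closed R ?T"
  proof -
    obtain t where t: "t \<in> T" "t \<in> carrier R'" using T by (auto simp: mult_closed_def)
    then obtain a where "a \<in> carrier R" "g a = t" using g_onto by (metis imageE)
    with t have "?T \<noteq> {}" by blast
    then show ?thesis using T ring_hom_mult[OF g] by (auto simp: mult_closed_def)
  qed
  have sg: "subgroup N (add_monoid M')" by (rule submodule.axioms(1)[OF N])
  have "subgroup ?N (add_monoid M)"
  proof
    fix x assume "x \<in> ?N"
    then show "inv\<^bsub>add_monoid M\<^esub> x \<in> ?N"
      using h.hom_inv[of x] subgroup.m_inv_closed[OF sg, of "h x"] M.add.inv_closed[of x]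
      by (simp add: a_inv_def)
  qed (use h.hom_one h.hom_mult subgroup.one_closed[OF sg] subgroup.m_closed[OF sg] in auto)
  moreover have "a \<odot>\<^bsub>M\<^esub> x \<in> ?N" if "a \<in> carrier R" "x \<in> ?N" for a x
    using that ring_hom_closed[OF g] submodule.smult_closed[OF N] by (auto simp: h_smult)
  ultimately have N': "submodule ?N R M"
    by (simp add: submodule_def submodule_axioms_def)
  have all_R: "(\<forall>b\<in>carrier R'. P b) \<longleftrightarrow> (\<forall>a\<in>carrier R. P (g a))" for P
    by (simp flip: g_onto)
  have all_M: "(\<forall>n\<in>carrier M'. P n) \<longleftrightarrow> (\<forall>m\<in>carrier M. P (h m))" for P
    by (simp flip: h_onto)
  have T_subset: "T \<subseteq> carrier R'" using T by (simp add: mult_closed_def)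
  have T_image: "g ` ?T = T"
  proof
    show "T \<subseteq> g ` ?T"
    proof
      fix t assume "t \<in> T"
      with T_subset g_onto obtain a where "a \<in> carrier R" "g a = t" by (metis imageE subsetD)
      with \<open>t \<in> T\<close> show "t \<in> g ` ?T" by blast
    qed
  qed auto
  have ex_T: "(\<exists>t\<in>T. P t) \<longleftrightarrow> (\<exists>t\<in>?T. P (g t))" for P
    by (subst T_image[symmetric]) (rule bex_simps(7))
  have colon: "g a \<in> colon_ring R' M' N (carrier M') \<longleftrightarrow> a \<in> colon_ring R M ?N (carrier M)"
    if "a \<in> carrier R" for a
    using that ring_hom_closed[OF g] by (simp add: colon_ring_def all_M h_smult)
  have disjoint: "colon_ring R' M' N (carrier M') \<inter> T = {} \<longleftrightarrow>
      colon_ring R M ?N (carrier M) \<inter> ?T = {}"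
  proof -
    have "(\<exists>t\<in>T. t \<in> colon_ring R' M' N (carrier M')) \<longleftrightarrow>
        (\<exists>t\<in>?T. t \<in> colon_ring R M ?N (carrier M))"
      unfolding ex_T using colon by blast
    then show ?thesis by blast
  qed
  have "(\<exists>t\<in>T. \<forall>b\<in>carrier R'. \<forall>n\<in>carrier M'. b \<odot>\<^bsub>M'\<^esub> n \<in> N \<longrightarrow>
        t \<otimes>\<^bsub>R'\<^esub> b \<in> colon_ring R' M' N (carrier M') \<or> t \<odot>\<^bsub>M'\<^esub> n \<in> N) \<longleftrightarrow>
      (\<exists>t\<in>?T. \<forall>a\<in>carrier R. \<forall>m\<in>carrier M. a \<odot>\<^bsub>M\<^esub> m \<in> ?N \<longrightarrow>
        t \<otimes>\<^bsub>R\<^esub> a \<in> colon_ring R M ?N (carrier M) \<or> t \<odot>\<^bsub>M\<^esub> m \<in> ?N)"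
    unfolding ex_T all_R all_M
    by (intro bex_cong ball_cong refl)
       (simp add: h_smult ring_hom_mult[OF g] flip: colon)
  with M M' T T' N N' disjoint show ?thesis unfolding S_prime_submodule_def by simp
qed

lemma (in module) submodule_colon_mod:
  assumes J: "J \<subseteq> carrier R" and N: "submodule N R M"
  shows "submodule (colon_mod M N J) R M"
proof -
  note N_rules = submoduleE[OF N]
  have zero: "\<zero>\<^bsub>M\<^esub> \<in> N"
    using subgroup.one_closed[OF submodule.axioms(1)[OF N]] by simp
  show ?thesis
  proof (rule submoduleI)
    fix x assume "x \<in> colon_mod M N J"
    then show "\<ominus>\<^bsub>M\<^esub> x \<in> colon_mod M N J"
      using J N_rules(3) smult_r_minus by (auto simp: colon_mod_def subset_iff)
  next
    fix a x assume a: "a \<in> carrier R" and x: "x \<in> colon_mod M N J"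
    have "j \<odot>\<^bsub>M\<^esub> (a \<odot>\<^bsub>M\<^esub> x) = a \<odot>\<^bsub>M\<^esub> (j \<odot>\<^bsub>M\<^esub> x)" if "j \<in> J" for j
      using that J a x R.m_comm[of j a] by (auto simp: colon_mod_def simp flip: smult_assoc1)
    then show "a \<odot>\<^bsub>M\<^esub> x \<in> colon_mod M N J"
      using a x N_rules(4) by (auto simp: colon_mod_def)
  qed (use J zero N_rules(5) in \<open>auto simp: colon_mod_def subset_iff smult_r_distr\<close>)
qed

text \<open>The elements that \<open>s\<close> multiplies into \<open>N\<close> form a subgroup, so only the products \<open>j m\<close> that
  generate \<open>J M\<close> matter.\<close>

lemma (in module) colon_ring_ideal_smultI:
  assumes J: "J \<subseteq> carrier R" and N: "submodule N R M" and s: "s \<in> carrier R"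
    and gens: "\<And>j m. j \<in> J \<Longrightarrow> m \<in> carrier M \<Longrightarrow> s \<odot>\<^bsub>M\<^esub> (j \<odot>\<^bsub>M\<^esub> m) \<in> N"
  shows "s \<in> colon_ring R M N (ideal_smult J M)"
proof -
  have "submodule (colon_mod M N {s}) R M"
    using s by (intro submodule_colon_mod N) auto
  then have "subgroup (colon_mod M N {s}) (add_monoid M)" by (rule submodule.axioms(1))
  moreover have "{j \<odot>\<^bsub>M\<^esub> m | j m. j \<in> J \<and> m \<in> carrier M} \<subseteq> colon_mod M N {s}"
    using J gens by (auto simp: colon_mod_def)
  ultimately have "ideal_smult J M \<subseteq> colon_mod M N {s}"
    unfolding ideal_smult_def
    by (intro group.generate_subgroup_incl[OF a_group])
  then show ?thesis using s by (auto simp: colon_ring_def colon_mod_def)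
qed

text \<open>If \<open>a m\<close> lies in \<open>(N : J)\<close>, apply primeness of \<open>N\<close> to \<open>a (j m) \<in> N\<close> for every \<open>j \<in> J\<close>: either
  \<open>t a\<close> sends \<open>M\<close> into \<open>N\<close>, which is contained in \<open>(N : J)\<close>, or all \<open>t (j m)\<close> lie in \<open>N\<close>, that is,
  \<open>t m\<close> lies in \<open>(N : J)\<close>.\<close>

lemma S_prime_submodule_colon_mod:
  fixes R (structure)
  assumes prime: "S_prime_submodule R M S N" and J: "J \<subseteq> carrier R"
    and disj: "colon_ring R M N (ideal_smult J M) \<inter> S = {}"
  shows "S_prime_submodule R M S (colon_mod M N J)"
proof -
  interpret M: module R M using prime by (simp add: S_prime_submodule_def)
  have S: "mult_closed R S" and N: "submodule N R M"
    using prime by (simp_all add: S_prime_submodule_def)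
  have S_carrier: "s \<in> carrier R" if "s \<in> S" for s
    using that S by (auto simp: mult_closed_def)
  have swap: "j \<odot>\<^bsub>M\<^esub> (a \<odot>\<^bsub>M\<^esub> m) = a \<odot>\<^bsub>M\<^esub> (j \<odot>\<^bsub>M\<^esub> m)"
    if "j \<in> J" "a \<in> carrier R" "m \<in> carrier M" for j a m
    using that J M.R.m_comm[of j a] by (auto simp flip: M.smult_assoc1)
  have N_le: "N \<subseteq> colon_mod M N J"
    using M.submoduleE(1,4)[OF N] J by (auto simp: colon_mod_def)
  have colon_disj: "colon_ring R M (colon_mod M N J) (carrier M) \<inter> S = {}"
  proof -
    have False if s: "s \<in> S" and sM: "s \<in> colon_ring R M (colon_mod M N J) (carrier M)" for s
    proof -
      have "s \<odot>\<^bsub>M\<^esub> (j \<odot>\<^bsub>M\<^esub> m) \<in> N" if "j \<in> J" "m \<in> carrier M" for j m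
        using that sM S_carrier[OF s] by (auto simp: colon_ring_def colon_mod_def simp flip: swap)
      then have "s \<in> colon_ring R M N (ideal_smult J M)"
        by (intro M.colon_ring_ideal_smultI J N S_carrier s)
      with s disj show False by blast
    qed
    then show ?thesis by blast
  qed
  obtain t where t: "t \<in> S"
    and t_prime: "\<And>a m. a \<in> carrier R \<Longrightarrow> m \<in> carrier M \<Longrightarrow> a \<odot>\<^bsub>M\<^esub> m \<in> N \<Longrightarrow>
      t \<otimes> a \<in> colon_ring R M N (carrier M) \<or> t \<odot>\<^bsub>M\<^esub> m \<in> N"
    using prime unfolding S_prime_submodule_def by blast
  have "t \<otimes> a \<in> colon_ring R M (colon_mod M N J) (carrier M) \<or> t \<odot>\<^bsub>M\<^esub> m \<in> colon_mod M N J"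
    if a: "a \<in> carrier R" and m: "m \<in> carrier M" and am: "a \<odot>\<^bsub>M\<^esub> m \<in> colon_mod M N J" for a m
  proof (cases "t \<otimes> a \<in> colon_ring R M N (carrier M)")
    case True
    then show ?thesis using N_le by (auto simp: colon_ring_def)
  next
    case False
    have "j \<odot>\<^bsub>M\<^esub> (t \<odot>\<^bsub>M\<^esub> m) \<in> N" if j: "j \<in> J" for j
    proof -
      have "a \<odot>\<^bsub>M\<^esub> (j \<odot>\<^bsub>M\<^esub> m) \<in> N" using am j by (simp add: colon_mod_def flip: swap[OF j a m])
      with False t_prime[of a "j \<odot>\<^bsub>M\<^esub> m"] a m j J have "t \<odot>\<^bsub>M\<^esub> (j \<odot>\<^bsub>M\<^esub> m) \<in> N" by auto
      with j m S_carrier[OF t] show ?thesis by (simp add: swap[of j t m])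
    qed
    then show ?thesis using m S_carrier[OF t] by (simp add: colon_mod_def)
  qed
  with t colon_disj S M.module_axioms M.submodule_colon_mod[OF J N] show ?thesis
    unfolding S_prime_submodule_def by blast
qed

context amalgamation
begin

lemma amalg_mult_set_eq_vimage: "amalg_mult_set R\<^sub>1 R\<^sub>2 f J S = {a \<in> carrier RR. snd a \<in> S}"
  by (auto simp: amalg_mult_set_def amalg_ring_def)

lemma amalg_submodule_eq_vimage: "amalg_submodule J M\<^sub>1 M\<^sub>2 \<phi> N = {p \<in> carrier MM. snd p \<in> N}"
  by (auto simp: amalg_submodule_def amalg_module_def)

lemma snd_ring_hom: "snd \<in> ring_hom RR R\<^sub>2"
  by (rule ring_hom_memI) (auto simp: RR_ops RR_carrier_iff)

lemma snd_module_hom: "snd \<in> hom (add_monoid MM) (add_monoid M\<^sub>2)"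
  by (rule homI) (auto simp: MM_add MM_carrier_iff)

lemma snd_smult:
  "a \<in> carrier RR \<Longrightarrow> p \<in> carrier MM \<Longrightarrow> snd (a \<odot>\<^bsub>MM\<^esub> p) = snd a \<odot>\<^bsub>M\<^sub>2\<^esub> snd p"
  by (cases a; cases p) (simp add: MM_smult)

lemma snd_ring_onto:
  assumes "f ` carrier R\<^sub>1 = carrier R\<^sub>2"
  shows "snd ` carrier RR = carrier R\<^sub>2"
proof
  show "carrier R\<^sub>2 \<subseteq> snd ` carrier RR"
  proof
    fix s assume "s \<in> carrier R\<^sub>2"
    with assms obtain r where "r \<in> carrier R\<^sub>1" "s = f r" by blast
    then have "(r, s) \<in> carrier RR" by (simp add: RR_carrier_iff a_minus_def R2.r_neg)
    then show "s \<in> snd ` carrier RR" by force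
  qed
qed (auto simp: RR_carrier_iff)

lemma snd_module_onto:
  assumes "\<phi> ` carrier M\<^sub>1 = carrier M\<^sub>2"
  shows "snd ` carrier MM = carrier M\<^sub>2"
proof
  have zero: "\<zero>\<^bsub>M\<^sub>2\<^esub> \<in> JM"
    using subgroup.one_closed[OF submodule.axioms(1)[OF JM_submodule]] by simp
  show "carrier M\<^sub>2 \<subseteq> snd ` carrier MM"
  proof
    fix y assume "y \<in> carrier M\<^sub>2"
    with assms obtain x where "x \<in> carrier M\<^sub>1" "y = \<phi> x" by blast
    then have "(x, y) \<in> carrier MM" using zero by (intro MM_carrierI[of x "\<zero>\<^bsub>M\<^sub>2\<^esub>"]) auto
    then show "y \<in> snd ` carrier MM" by force
  qed
qed (auto simp: MM_carrier_iff)

lemma S_prime_amalg_submodule_iff: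
  assumes "f ` carrier R\<^sub>1 = carrier R\<^sub>2" "\<phi> ` carrier M\<^sub>1 = carrier M\<^sub>2"
    and "mult_closed R\<^sub>2 S" "submodule N R\<^sub>2 M\<^sub>2"
  shows "S_prime_submodule R\<^sub>2 M\<^sub>2 S N \<longleftrightarrow>
    S_prime_submodule RR MM (amalg_mult_set R\<^sub>1 R\<^sub>2 f J S) (amalg_submodule J M\<^sub>1 M\<^sub>2 \<phi> N)"
  unfolding amalg_mult_set_eq_vimage amalg_submodule_eq_vimage
  by (intro S_prime_submodule_vimage_iff MM_module M2.module_axioms snd_ring_hom snd_ring_onto
      snd_module_hom snd_module_onto snd_smult assms)

end

theorem theorem9:
  fixes R\<^sub>1 :: "'a ring" and R\<^sub>2 :: "'c ring"
    and M\<^sub>1 :: "('a, 'b) module" and M\<^sub>2 :: "('c, 'd) module"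
    and f :: "'a \<Rightarrow> 'c" and \<phi> :: "'b \<Rightarrow> 'd"
    and J S :: "'c set" and N\<^sub>2 :: "'d set"
  assumes "cring R\<^sub>1" and "\<one>\<^bsub>R\<^sub>1\<^esub> \<noteq> \<zero>\<^bsub>R\<^sub>1\<^esub>"
    and "cring R\<^sub>2" and "\<one>\<^bsub>R\<^sub>2\<^esub> \<noteq> \<zero>\<^bsub>R\<^sub>2\<^esub>"
    and "f \<in> ring_hom R\<^sub>1 R\<^sub>2" and "f ` carrier R\<^sub>1 = carrier R\<^sub>2"
    and "ideal J R\<^sub>2"
    and "module R\<^sub>1 M\<^sub>1" and "module R\<^sub>2 M\<^sub>2"
    and "\<phi> \<in> mod_hom R\<^sub>1 M\<^sub>1 (restrict_scalars f M\<^sub>2)"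
    and "\<phi> ` carrier M\<^sub>1 = carrier M\<^sub>2"
    and "mult_closed R\<^sub>2 S"
    and "submodule N\<^sub>2 R\<^sub>2 M\<^sub>2"
  shows
    "(S_prime_submodule R\<^sub>2 M\<^sub>2 S N\<^sub>2 \<longleftrightarrow>
        S_prime_submodule (amalg_ring R\<^sub>1 R\<^sub>2 f J) (amalg_module R\<^sub>1 R\<^sub>2 f J M\<^sub>1 M\<^sub>2 \<phi>)
          (amalg_mult_set R\<^sub>1 R\<^sub>2 f J S) (amalg_submodule J M\<^sub>1 M\<^sub>2 \<phi> N\<^sub>2)) \<and>
     (S_prime_submodule (amalg_ring R\<^sub>1 R\<^sub>2 f J) (amalg_module R\<^sub>1 R\<^sub>2 f J M\<^sub>1 M\<^sub>2 \<phi>)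
          (amalg_mult_set R\<^sub>1 R\<^sub>2 f J S) (amalg_submodule J M\<^sub>1 M\<^sub>2 \<phi> N\<^sub>2) \<and>
        colon_ring R\<^sub>2 M\<^sub>2 N\<^sub>2 (ideal_smult J M\<^sub>2) \<inter> S = {} \<longrightarrow>
      S_prime_submodule R\<^sub>2 M\<^sub>2 S (colon_mod M\<^sub>2 N\<^sub>2 J))"
proof -
  interpret amalgamation R\<^sub>1 R\<^sub>2 M\<^sub>1 M\<^sub>2 f J \<phi>
    by (intro amalgamation.intro amalgamation_axioms.intro assms)
  have "J \<subseteq> carrier R\<^sub>2" using J.Icarr by blast
  then show ?thesis
    using S_prime_amalg_submodule_iff[OF assms(6,11-13)]
      S_prime_submodule_colon_mod[of R\<^sub>2 M\<^sub>2 S N\<^sub>2 J]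
    by simp
qed

end
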